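(* Let $n\ge 1$, let $(S_i,\mathbb{S}_i)$, $i=1,\ldots,n$, be measurable spaces, $S=\prod_{i=1}^n S_i$, $\mathbb{S}=\bigotimes_{i=1}^n\mathbb{S}_i$, and let $\mathbf{X}=(X_1,\ldots,X_n)\in S$ be a random vector with distribution $P$, a probability measure on $(S,\mathbb{S})$ under which $X_1,\ldots,X_n$ are independent. Framework I. Let $\mathcal{A},\mathcal{B}$ be finite or countable index sets, and let $\{f_\alpha\}_{\alpha\in\mathcal{A}}$, $\{g_\beta\}_{\beta\in\mathcal{B}}$ be collections of non-negative real-valued $\mathbb{S}$-measurable functions on $S$ such that $f_\alpha$ depends on $K_\alpha\subseteq\mathbf{n}$ and $g_\beta$ depends on $L_\beta\subseteq\mathbf{n}$; put $\mathcal{K}=\{K_\alpha\}_{\alpha\in\mathcal{A}}$ and $\mathcal{L}=\{L_\beta\}_{\beta\in\mathcal{B}}$. Then: (c) $$E\Big\{\max_{K\in\mathcal{K},\,L\in\mathcal{L}:\ K\cap L=\emptyset}\tilde f_K(\mathbf{X})\,\tilde g_L(\mathbf{X})\Big\}\le E\Big\{\sup_{\alpha} f_\alpha(\mathbf{X})\Big\}\,E\Big\{\sup_\beta g_\beta(\mathbf{X})\Big\};$$ (d) for any given measurable functions $K(\mathbf{x})\in\mathcal{K}$ and $L(\mathbf{x})\in\mathcal{L}$ on $S$ such that $K(\mathbf{x})\cap L(\mathbf{x})=\emptyset$ for all $\mathbf{x}\in S$, $$E\big\{\tilde f_{K(\mathbf{X})}(\mathbf{X})\,\tilde g_{L(\mathbf{X})}(\mathbf{X})\big\}\le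 E\Big\{\sup_{\alpha} f_\alpha(\mathbf{X})\Big\}\,E\Big\{\sup_\beta g_\beta(\mathbf{X})\Big\}.$$ Framework II. Let $f,g$ be non-negative real-valued $\mathbb{S}$-measurable functions on $S$ and let $\mathcal{K},\mathcal{L}\subseteq 2^{\mathbf{n}}$ be any collections of subsets of $\mathbf{n}$. Then: (e) for any given measurable functions $K(\mathbf{x})\in\mathcal{K}$ and $L(\mathbf{x})\in\mathcal{L}$ on $S$ such that $K(\mathbf{x})\cap L(\mathbf{x})=\emptyset$ for all $\mathbf{x}\in S$, $$E\big\{\underline{f}_{K(\mathbf{X})}(\mathbf{X})\,\underline{g}_{L(\mathbf{X})}(\mathbf{X})\big\}\le E\{f(\mathbf{X})\}\,E\{g(\mathbf{X})\}.$$
   Context: $\mathbf{n}=\{1,\ldots,n\}$. For $\mathbf{x}\in S$ and $K\subseteq\mathbf{n}$, $\mathbf{x}_K$ is the restriction of $\mathbf{x}$ to the coordinates in $K$, and $[\mathbf{x}]_K=\{\mathbf{y}\in S:\mathbf{y}_K=\mathbf{x}_K\}$. A function $f$ on $S$ depends on $K$ if $\mathbf{x}_K=\mathbf{y}_K$ implies $f(\mathbf{x})=f(\mathbf{y})$. The sets $K_\alpha$ (and likewise the $L_\beta$) need not be distinct. Functions on $S$ with values in $2^{\mathbf{n}}$ are measurable with respect to $\mathbb{S}$ and the discrete sigma algebra on $2^{\mathbf{n}}$. In Framework I, for $K,L\subseteq\mathbf{n}$, $$\tilde f_K(\mathbf{x})=\sup_{\alpha:\,K_\alpha\subseteq K}f_\alpha(\mathbf{x}),\qquad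 \tilde g_L(\mathbf{x})=\sup_{\beta:\,L_\beta\subseteq L}g_\beta(\mathbf{x}),$$ and $\tilde f_{K(\mathbf{x})}(\mathbf{x})=\sup_{\alpha:\,K_\alpha\subseteq K(\mathbf{x})}f_\alpha(\mathbf{x})$, $\tilde g_{L(\mathbf{x})}(\mathbf{x})=\sup_{\beta:\,L_\beta\subseteq L(\mathbf{x})}g_\beta(\mathbf{x})$. In Framework II, for $K\subseteq\mathbf{n}$, $\underline{f}_K(\mathbf{x})=\operatorname{ess\,inf}_{\mathbf{y}\in[\mathbf{x}]_K}f(\mathbf{y})$, where the essential infimum is taken over the coordinates of $\mathbf{y}$ in $K^c$, with respect to the marginal $P_{K^c}$ of $P$ on those coordinates (the coordinates in $K$ being fixed equal to $\mathbf{x}_K$); $\underline{g}_L$ is defined in the same way; for $K=\mathbf{n}$, $\underline f_K=f$. The quantity $\underline{f}_{K(\mathbf{x})}(\mathbf{x})$ is $\underline{f}_K(\mathbf{x})$ evaluated at $K=K(\mathbf{x})$, and similarly for $\underline{g}_{L(\mathbf{x})}(\mathbf{x})$. Expectations take values in $[0,\infty]$, $0\cdot\infty=0$, and the supremum (maximum) of an empty collection of non-negative quantities is $0$. *)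

theory Defs
  imports "HOL-Probability.Probability"
begin

text \<open>
  The coordinate spaces are a family \<open>S :: nat \<Rightarrow> 'a measure\<close>, of which only the measurable
  structure is used; \<open>S i\<close> may vary with \<open>i\<close> inside the common type \<open>'a\<close>.  The product space is
  \<open>\<Pi>\<^sub>M i\<in>{1..n}. S i\<close>, and its points are functions that are \<open>undefined\<close> outside \<open>{1..n}\<close>.
\<close>

definition depends_on :: "('i \<Rightarrow> 'a) set \<Rightarrow> (('i \<Rightarrow> 'a) \<Rightarrow> 'b) \<Rightarrow> 'i set \<Rightarrow> bool" where
  "depends_on \<Omega> f K \<longleftrightarrow> (\<forall>x\<in>\<Omega>. \<forall>y\<in>\<Omega>. restrict x K = restrict y K \<longrightarrow> f x = f y)"

text \<open>Non-negativity and dependence are only required on the product space, not on the whole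
  function type.\<close>

definition dependent_family ::
  "nat \<Rightarrow> (nat \<Rightarrow> 'a measure) \<Rightarrow> 'k set \<Rightarrow> ('k \<Rightarrow> (nat \<Rightarrow> 'a) \<Rightarrow> real) \<Rightarrow> ('k \<Rightarrow> nat set) \<Rightarrow> bool"
where
  "dependent_family n S A f K \<longleftrightarrow> countable A \<and>
     (\<forall>\<alpha>\<in>A. K \<alpha> \<subseteq> {1..n} \<and>
        f \<alpha> \<in> borel_measurable (\<Pi>\<^sub>M i\<in>{1..n}. S i) \<and>
        (\<forall>x\<in>space (\<Pi>\<^sub>M i\<in>{1..n}. S i). 0 \<le> f \<alpha> x) \<and>
        depends_on (space (\<Pi>\<^sub>M i\<in>{1..n}. S i)) (f \<alpha>) (K \<alpha>))"

text \<open>The supremum may be infinite, hence the values in \<open>ennreal\<close>, where \<open>Sup {} = 0\<close> and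
  \<open>0 * \<infinity> = 0\<close>.\<close>

definition sup_within ::
  "'k set \<Rightarrow> ('k \<Rightarrow> (nat \<Rightarrow> 'a) \<Rightarrow> real) \<Rightarrow> ('k \<Rightarrow> nat set) \<Rightarrow> nat set \<Rightarrow> (nat \<Rightarrow> 'a) \<Rightarrow> ennreal"
where
  "sup_within A f K J x = (SUP \<alpha>\<in>{\<alpha>\<in>A. K \<alpha> \<subseteq> J}. ennreal (f \<alpha> x))"

definition ess_inf :: "'a measure \<Rightarrow> ('a \<Rightarrow> ennreal) \<Rightarrow> ennreal" where
  "ess_inf M f = Sup {c. AE x in M. c \<le> f x}"

definition marginal :: "(nat \<Rightarrow> 'a measure) \<Rightarrow> (nat \<Rightarrow> 'a) measure \<Rightarrow> nat set \<Rightarrow> (nat \<Rightarrow> 'a) measure" where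
  "marginal S P J = distr P (\<Pi>\<^sub>M i\<in>J. S i) (\<lambda>x. restrict x J)"

text \<open>The point \<open>merge K ({1..n} - K) (x, z)\<close> has the coordinates of \<open>x\<close> in \<open>K\<close> and those of \<open>z\<close>
  in the complement of \<open>K\<close>; it runs over all \<open>y\<close> with \<open>y\<^sub>K = x\<^sub>K\<close> as \<open>z\<close> varies.\<close>

definition lower_fun ::
  "nat \<Rightarrow> (nat \<Rightarrow> 'a measure) \<Rightarrow> (nat \<Rightarrow> 'a) measure \<Rightarrow> ((nat \<Rightarrow> 'a) \<Rightarrow> real) \<Rightarrow> nat set \<Rightarrow>
    (nat \<Rightarrow> 'a) \<Rightarrow> ennreal"
where
  "lower_fun n S P f K x =
     ess_inf (marginal S P ({1..n} - K)) (\<lambda>z. ennreal (f (merge K ({1..n} - K) (x, z))))"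

definition disjoint_choice ::
  "nat \<Rightarrow> (nat \<Rightarrow> 'a measure) \<Rightarrow> nat set set \<Rightarrow> nat set set \<Rightarrow>
    ((nat \<Rightarrow> 'a) \<Rightarrow> nat set) \<Rightarrow> ((nat \<Rightarrow> 'a) \<Rightarrow> nat set) \<Rightarrow> bool"
where
  "disjoint_choice n S \<K> \<L> \<kappa> \<mu> \<longleftrightarrow>
     \<kappa> \<in> (\<Pi>\<^sub>M i\<in>{1..n}. S i) \<rightarrow>\<^sub>M count_space (Pow {1..n}) \<and>
     \<mu> \<in> (\<Pi>\<^sub>M i\<in>{1..n}. S i) \<rightarrow>\<^sub>M count_space (Pow {1..n}) \<and>
     (\<forall>x\<in>space (\<Pi>\<^sub>M i\<in>{1..n}. S i). \<kappa> x \<in> \<K> \<and> \<mu> x \<in> \<L> \<and> \<kappa> x \<inter> \<mu> x = {})"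

lemma ess_inf_eq_Liminf: "ess_inf M f = Liminf (ae_filter M) f"
proof (rule antisym)
  show "ess_inf M f \<le> Liminf (ae_filter M) f"
    unfolding ess_inf_def by (rule Sup_least) (auto intro: Liminf_bounded)
  have "(INF x\<in>Collect Q. f x) \<le> Sup {c. AE x in M. c \<le> f x}" if Q: "AE x in M. Q x" for Q
    using Q by (intro Sup_upper) (auto elim!: eventually_mono intro: INF_lower)
  then show "Liminf (ae_filter M) f \<le> ess_inf M f"
    unfolding Liminf_def ess_inf_def by (auto intro!: SUP_least)
qed

lemma lower_fun_full:
  assumes "prob_space P" and [measurable_cong]: "sets P = sets (\<Pi>\<^sub>M i\<in>{1..n}. S i)"
    and x: "x \<in> space (\<Pi>\<^sub>M i\<in>{1..n}. S i)"
  shows "lower_fun n S P f {1..n} x = ennreal (f x)"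
proof -
  have "merge {1..n} {} (x, z) = x" for z
    using x by (auto simp: merge_def space_PiM PiE_def extensional_def fun_eq_iff)
  moreover have "prob_space (marginal S P {})"
    unfolding marginal_def by (intro prob_space.prob_space_distr assms(1)) measurable
  ultimately show ?thesis
    by (simp add: lower_fun_def ess_inf_def prob_space.AE_const flip: atMost_def)
qed

end

theory Submission
  imports Defs
begin

text \<open>
All three inequalities are instances of a functional form of the van den Berg--Kesten--Reimer
inequality, \<open>functional_bkr\<close>: if \<open>F K\<close> and \<open>G K\<close> depend only on the coordinates in \<open>K\<close>, then the
maximum of \<open>F K * G L\<close> over disjoint \<open>K\<close> and \<open>L\<close> has expectation at most the product of the
expectations of the maxima of \<open>F\<close> and of \<open>G\<close>.  In the first framework \<open>F K\<close> is \<open>sup_within\<close>, whose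
maximum over \<open>K\<close> is at most the supremum of the family; in the second one \<open>F K\<close> is \<open>lower_fun\<close>, which
is at most \<open>f\<close> almost surely (\<open>AE_lower_fun_le\<close>).  A measurable choice of disjoint sets is dominated
pointwise by the maximum.

Arbitrary product spaces need no discretization.  Replace the random point by a pair of independent
copies and swap the coordinates in a random set \<open>T\<close>; this does not change the law of the pair.  Given
the two copies, only \<open>T\<close> remains random, and the claim becomes an inequality between sums over the
uniform cube of all \<open>T\<close>, in which the complement of \<open>T\<close> plays the role of the independent second
copy.  A layer-cake decomposition reduces functions to sets, and what is left is Reimer's
combinatorial inequality \<open>reimer_butterfly\<close>: the number of vertices at which \<open>A\<close> and \<open>B\<close> occur
disjointly is at most the number of vertices that lie in \<open>A\<close> and have their antipode in \<open>B\<close>.  Its proof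
is linear algebra on the vector space of functions on the cube, with product vectors depending on
one integer parameter \<open>N\<close>: one family of vectors is independent because \<open>N\<close> is even, a second
family, whose relevant members are orthogonal to the first, because \<open>N\<close> is large.
\<close>

section \<open>Integer linear systems\<close>

text \<open>
A homogeneous system with more unknowns than equations has a nontrivial solution.  Integrality of
the solution is what makes the parity argument of the next lemma applicable.
\<close>

lemma nontrivial_integer_solution:
  fixes a :: "'a \<Rightarrow> 'b \<Rightarrow> int"
  assumes "finite T" "finite X" "card T < card X"
  shows "\<exists>c. (\<exists>x\<in>X. c x \<noteq> 0) \<and> (\<forall>t\<in>T. (\<Sum>x\<in>X. c x * a x t) = 0)"
  using assms
proof (induction T arbitrary: X a rule: finite_induct)
  case empty
  then have "X \<noteq> {}" by auto
  then show ?case by (intro exI[of _ "\<lambda>_. 1"]) auto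
next
  case (insert t T)
  show ?case
  proof (cases "\<forall>x\<in>X. a x t = 0")
    case True
    then show ?thesis using insert.IH[of X a] insert.prems insert.hyps by auto
  next
    case False
    then obtain p where p: "p \<in> X" "a p t \<noteq> 0" by blast
    define X' where "X' = X - {p}"
    have X: "X = insert p X'" "p \<notin> X'" "finite X'"
      using p insert.prems by (auto simp: X'_def)
    \<comment> \<open>Gaussian elimination with pivot \<open>a p t\<close>; multiplying by the pivot, rather than dividing by
      it, keeps the coefficients integral.\<close>
    obtain c where c: "\<exists>x\<in>X'. c x \<noteq> 0"
      "\<forall>s\<in>T. (\<Sum>x\<in>X'. c x * (a p t * a x s - a x t * a p s)) = 0"
      using insert.IH[of X' "\<lambda>x s. a p t * a x s - a x t * a p s"] insert.prems insert.hyps X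
      by auto
    define d where "d x = (if x = p then - (\<Sum>x\<in>X'. c x * a x t) else a p t * c x)" for x
    have "(\<Sum>x\<in>X. d x * a x s) = (\<Sum>x\<in>X'. c x * (a p t * a x s - a x t * a p s))" for s
    proof -
      have "(\<Sum>x\<in>X. d x * a x s) = d p * a p s + (\<Sum>x\<in>X'. d x * a x s)"
        using X by simp
      also have "(\<Sum>x\<in>X'. d x * a x s) = (\<Sum>x\<in>X'. a p t * c x * a x s)"
        using X by (intro sum.cong) (auto simp: d_def)
      also have "d p * a p s = - (\<Sum>x\<in>X'. c x * a x t * a p s)"
        by (simp add: d_def sum_distrib_right)
      also have "- (\<Sum>x\<in>X'. c x * a x t * a p s) + (\<Sum>x\<in>X'. a p t * c x * a x s)
          = (\<Sum>x\<in>X'. c x * (a p t * a x s - a x t * a p s))"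
        unfolding sum_negf[symmetric] sum.distrib[symmetric] by (simp add: algebra_simps)
      finally show ?thesis .
    qed
    moreover have "\<exists>x\<in>X. d x \<noteq> 0"
      using c(1) p X by (auto simp: d_def)
    ultimately show ?thesis
      using c(2) by (intro exI[of _ d]) auto
  qed
qed

text \<open>
The matrix is invertible modulo every power of \<open>2\<close>, so a kernel vector is divisible by all of them:
if \<open>c = 2 ^ k * d\<close>, then \<open>d\<close> is in the kernel as well, and reducing its equations modulo \<open>2\<close> shows
that \<open>d\<close> is even.
\<close>

lemma unit_mod_2_kernel_zero:
  fixes m :: "'a \<Rightarrow> 'a \<Rightarrow> int"
  assumes X: "finite X"
    and odd: "\<And>x. x \<in> X \<Longrightarrow> odd (m x x)"
    and even: "\<And>x y. x \<in> X \<Longrightarrow> y \<in> X \<Longrightarrow> x \<noteq> y \<Longrightarrow> even (m x y)"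
    and eq: "\<And>y. y \<in> X \<Longrightarrow> (\<Sum>x\<in>X. c x * m x y) = 0"
    and y: "y \<in> X"
  shows "c y = 0"
proof -
  have "\<forall>x\<in>X. 2 ^ k dvd c x" for k
  proof (induction k)
    case (Suc k)
    then obtain d where d: "\<And>x. x \<in> X \<Longrightarrow> c x = 2 ^ k * d x"
      unfolding dvd_def by metis
    show ?case
    proof
      fix y assume y: "y \<in> X"
      have "2 ^ k * (\<Sum>x\<in>X. d x * m x y) = (\<Sum>x\<in>X. c x * m x y)"
        using d by (simp add: sum_distrib_left mult.assoc)
      then have "(\<Sum>x\<in>X. d x * m x y) = 0"
        using eq[OF y] by simp
      then have "d y * m y y = - (\<Sum>x\<in>X - {y}. d x * m x y)"
        using sum.remove[OF X y, of "\<lambda>x. d x * m x y"] by simp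
      moreover have "even (\<Sum>x\<in>X - {y}. d x * m x y)"
        using even y by (intro dvd_sum) auto
      ultimately have "even (d y)"
        using odd[OF y] by (metis dvd_minus_iff even_mult_iff)
      then show "2 ^ Suc k dvd c y"
        using d[OF y] by (auto simp: dvd_def)
    qed
  qed simp
  with y have *: "2 ^ k dvd c y" for k by blast
  show ?thesis
  proof (rule ccontr)
    assume "c y \<noteq> 0"
    then have "2 ^ nat \<bar>c y\<bar> \<le> \<bar>c y\<bar>"
      using * by (metis abs_ge_self abs_numeral dvd_imp_le_int order.trans power_abs)
    moreover have "nat \<bar>c y\<bar> < 2 ^ nat \<bar>c y\<bar>" by (rule less_exp)
    ultimately show False
      by (metis nat_less_eq_zless of_nat_less_iff int_nat_eq abs_ge_zero not_le of_nat_numeral of_nat_power)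
  qed
qed

text \<open>
The equation belonging to an entry of \<open>w\<close> of maximal absolute value can only hold if this entry
is \<open>0\<close>.
\<close>

lemma diagonally_dominant_kernel_zero:
  fixes b :: "'a \<Rightarrow> 'a \<Rightarrow> int"
  assumes Z: "finite Z"
    and dom: "\<And>y. y \<in> Z \<Longrightarrow> (\<Sum>z\<in>Z - {y}. \<bar>b y z\<bar>) < \<bar>b y y\<bar>"
    and eq: "\<And>y. y \<in> Z \<Longrightarrow> (\<Sum>z\<in>Z. b y z * w z) = 0"
    and z: "z \<in> Z"
  shows "w z = 0"
proof -
  have "Max ((\<lambda>z. \<bar>w z\<bar>) ` Z) \<in> (\<lambda>z. \<bar>w z\<bar>) ` Z"
    using Z z by (intro Max_in) auto
  then obtain y where y: "y \<in> Z" "Max ((\<lambda>z. \<bar>w z\<bar>) ` Z) = \<bar>w y\<bar>" by auto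
  have le: "\<bar>w z\<bar> \<le> \<bar>w y\<bar>" if "z \<in> Z" for z
    using that Z y(2) by (metis Max_ge finite_imageI imageI)
  have "b y y * w y = - (\<Sum>z\<in>Z - {y}. b y z * w z)"
    using eq[OF y(1)] sum.remove[OF Z y(1), of "\<lambda>z. b y z * w z"] by simp
  then have "\<bar>b y y\<bar> * \<bar>w y\<bar> = \<bar>\<Sum>z\<in>Z - {y}. b y z * w z\<bar>"
    by (metis abs_minus_cancel abs_mult)
  also have "\<dots> \<le> (\<Sum>z\<in>Z - {y}. \<bar>b y z\<bar> * \<bar>w y\<bar>)"
    by (rule order.trans[OF sum_abs]) (auto simp: abs_mult intro!: sum_mono mult_left_mono le)
  finally have "\<bar>b y y\<bar> * \<bar>w y\<bar> \<le> (\<Sum>z\<in>Z - {y}. \<bar>b y z\<bar>) * \<bar>w y\<bar>"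
    by (simp add: sum_distrib_right)
  with dom[OF y(1)] have "\<bar>w y\<bar> = 0"
    by (meson abs_ge_zero linorder_not_less mult_strict_right_mono order.not_eq_order_implies_strict)
  with le[OF z] show ?thesis by simp
qed

section \<open>Reimer's inequality on the cube\<close>

text \<open>
A vertex of the cube \<open>{0,1}\<^sup>V\<close> is encoded as a subset of \<open>V\<close>, and a vector on the cube as a function
of a subset.  The vector below is a tensor product of vectors in the plane spanned by the unit
vectors \<open>e\<^sub>0\<close> and \<open>e\<^sub>1\<close>: if \<open>x\<close> has bit \<open>a\<close> at the coordinate \<open>i\<close>, the factor is \<open>e\<^sub>a\<close> for \<open>i \<in> K\<close> and
\<open>e\<^sub>a - N e\<^sub>b\<close> with the opposite bit \<open>b\<close> for \<open>i \<notin> K\<close>.  It is supported on the subcube of vertices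
that agree with \<open>x\<close> on \<open>K\<close>.
\<close>

definition subcube_vec :: "int \<Rightarrow> 'a set \<Rightarrow> 'a set \<Rightarrow> 'a set \<Rightarrow> int" where
  "subcube_vec N K x z = (if sym_diff x z \<inter> K = {} then (- N) ^ card (sym_diff x z) else 0)"

text \<open>
Up to the factor \<open>N ^ card V\<close>, which clears denominators, the tensor product with the factor
\<open>e\<^sub>a + (1/N) e\<^sub>b\<close> at every coordinate, where \<open>a\<close> is the bit of \<open>y\<close> and \<open>b\<close> the opposite bit.
\<close>

definition distance_vec :: "int \<Rightarrow> 'a set \<Rightarrow> 'a set \<Rightarrow> 'a set \<Rightarrow> int" where
  "distance_vec N V y z = N ^ (card V - card (sym_diff y z))"

text \<open>
The factors of the two tensor products at the coordinate \<open>i\<close> are orthogonal: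
\<open>1 \<cdot> 1 + (- N) \<cdot> (1/N) = 0\<close>.  In terms of the sum, toggling \<open>i\<close> is an involution of the cube that
changes the sign of every summand.
\<close>

lemma subcube_vec_orthogonal_distance_vec:
  assumes V: "finite V" and x: "x \<subseteq> V" and y: "y \<subseteq> V"
    and i: "i \<in> V" "i \<notin> K" "i \<in> y \<longleftrightarrow> i \<in> x"
  shows "(\<Sum>z\<in>Pow V. distance_vec N V y z * subcube_vec N K x z) = 0"
proof -
  let ?t = "\<lambda>z. distance_vec N V y z * subcube_vec N K x z"
  let ?\<tau> = "\<lambda>z. sym_diff z {i}"
  have agree: "?t (?\<tau> z) = - ?t z" if z: "z \<subseteq> V" and iz: "i \<in> z \<longleftrightarrow> i \<in> x" for z
  proof -
    have eq: "sym_diff x (?\<tau> z) = insert i (sym_diff x z)" "sym_diff y (?\<tau> z) = insert i (sym_diff y z)"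
      using iz i by auto
    have notin: "i \<notin> sym_diff x z" "i \<notin> sym_diff y z"
      using iz i by auto
    have fin: "finite (sym_diff x z)" "finite (sym_diff y z)"
      using V x y z by (auto intro: finite_subset)
    have "insert i (sym_diff y z) \<subseteq> V"
      using y z i by auto
    then have "card (insert i (sym_diff y z)) \<le> card V"
      by (rule card_mono[OF V])
    then have lt: "card (sym_diff y z) < card V"
      by (simp only: card_insert_disjoint[OF fin(2) notin(2)])
    then have pow: "N ^ (card V - card (sym_diff y z)) = N * N ^ (card V - Suc (card (sym_diff y z)))"
      by (metis Suc_diff_Suc power_Suc)
    have "(insert i (sym_diff x z) \<inter> K = {}) = (sym_diff x z \<inter> K = {})"
      using i by auto
    then show ?thesis
      unfolding distance_vec_def subcube_vec_def eq card_insert_disjoint[OF fin(1) notin(1)]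
        card_insert_disjoint[OF fin(2) notin(2)] pow
      by simp
  qed
  have flip: "?t (?\<tau> z) = - ?t z" if z: "z \<subseteq> V" for z
  proof (cases "i \<in> z \<longleftrightarrow> i \<in> x")
    case False
    have "?\<tau> z \<subseteq> V" "i \<in> ?\<tau> z \<longleftrightarrow> i \<in> x" "?\<tau> (?\<tau> z) = z"
      using z i False by auto
    with agree[of "?\<tau> z"] show ?thesis by (simp only:)
  qed (use agree z in blast)
  have "bij_betw ?\<tau> (Pow V) (Pow V)"
    using i by (intro bij_betwI[where g = ?\<tau>]) auto
  then have "(\<Sum>z\<in>Pow V. ?t z) = (\<Sum>z\<in>Pow V. ?t (?\<tau> z))"
    by (rule sum.reindex_bij_betw[symmetric])
  also have "\<dots> = - (\<Sum>z\<in>Pow V. ?t z)"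
    using flip by (simp add: sum_negf[symmetric] del: sum_negf)
  finally show ?thesis by simp
qed

text \<open>
Reimer's inequality for the uniform cube: \<open>X\<close> may be taken as the set of vertices at which \<open>A\<close> and
\<open>B\<close> occur disjointly, with \<open>A\<close> certified by the coordinates in \<open>\<kappa> x\<close> and \<open>B\<close> by the other ones.

Attach to \<open>x \<in> X\<close> the vector \<open>subcube_vec N (\<kappa> x) x\<close>; it vanishes outside \<open>A\<close>.  Let \<open>T\<close> be the set
whose size is to be bounded from below, and \<open>Z\<close> the rest of \<open>A\<close>.  If \<open>card T < card X\<close>, some
nontrivial integer combination \<open>w\<close> of the vectors vanishes on \<open>T\<close>, hence lives on \<open>Z\<close>.  For
\<open>y \<in> Z\<close> the complement of \<open>y\<close> is not in \<open>B\<close>, so it disagrees with every \<open>x \<in> X\<close> at some coordinate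
outside \<open>\<kappa> x\<close>; there \<open>y\<close> agrees with \<open>x\<close>, and \<open>w\<close> is orthogonal to \<open>distance_vec N V y\<close>.  Restricted
to \<open>Z\<close>, the vectors \<open>distance_vec N V y\<close> form a diagonally dominant matrix when \<open>N\<close> is large, so
\<open>w = 0\<close>; and the vectors \<open>subcube_vec N (\<kappa> x) x\<close> are unit vectors modulo \<open>2\<close> when \<open>N\<close> is even, so the
combination was trivial.
\<close>

proposition reimer_butterfly:
  assumes V: "finite V" and X: "X \<subseteq> Pow V"
    and A: "\<And>x y. x \<in> X \<Longrightarrow> y \<subseteq> V \<Longrightarrow> y \<inter> \<kappa> x = x \<inter> \<kappa> x \<Longrightarrow> y \<in> A"
    and B: "\<And>x y. x \<in> X \<Longrightarrow> y \<subseteq> V \<Longrightarrow> y \<inter> (V - \<kappa> x) = x \<inter> (V - \<kappa> x) \<Longrightarrow> y \<in> B"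
  shows "card X \<le> card {y. y \<subseteq> V \<and> y \<in> A \<and> V - y \<in> B}"
proof (rule ccontr)
  define T where "T = {y. y \<subseteq> V \<and> y \<in> A \<and> V - y \<in> B}"
  define Z where "Z = {y. y \<subseteq> V \<and> y \<in> A \<and> V - y \<notin> B}"
  \<comment> \<open>even, and larger than the number of vertices, as the two kernel lemmas demand\<close>
  define N :: int where "N = 2 * 2 ^ card V"
  assume "\<not> card X \<le> card {y. y \<subseteq> V \<and> y \<in> A \<and> V - y \<in> B}"
  then have less: "card T < card X" by (simp add: T_def)
  have sub: "T \<subseteq> Pow V" "Z \<subseteq> Pow V" by (auto simp: T_def Z_def)
  have fin: "finite X" "finite T" "finite Z"
    using V X sub by (auto intro: finite_subset)
  obtain c where c: "\<exists>x\<in>X. c x \<noteq> 0"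
    and T0: "\<And>t. t \<in> T \<Longrightarrow> (\<Sum>x\<in>X. c x * subcube_vec N (\<kappa> x) x t) = 0"
    using nontrivial_integer_solution[OF fin(2,1) less, of "\<lambda>x. subcube_vec N (\<kappa> x) x"] by blast
  define w where "w z = (\<Sum>x\<in>X. c x * subcube_vec N (\<kappa> x) x z)" for z
  have off: "w z = 0" if z: "z \<subseteq> V" "z \<notin> Z" for z
  proof (cases "z \<in> A")
    case True
    then show ?thesis using T0[of z] z by (auto simp: w_def Z_def T_def)
  next
    case False
    have "subcube_vec N (\<kappa> x) x z = 0" if "x \<in> X" for x
    proof -
      have "sym_diff x z \<inter> \<kappa> x \<noteq> {}"
        using A[OF that z(1)] False by auto
      then show ?thesis by (simp add: subcube_vec_def)
    qed
    then show ?thesis by (simp add: w_def)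
  qed
  have orth: "(\<Sum>z\<in>Z. distance_vec N V y z * w z) = 0" if y: "y \<in> Z" for y
  proof -
    have "(\<Sum>z\<in>Pow V. distance_vec N V y z * subcube_vec N (\<kappa> x) x z) = 0" if x: "x \<in> X" for x
    proof -
      have yV: "y \<subseteq> V" using y by (simp add: Z_def)
      have "\<not> (V - y) \<inter> (V - \<kappa> x) = x \<inter> (V - \<kappa> x)"
        using B[OF x, of "V - y"] y by (auto simp: Z_def)
      then obtain i where "i \<in> V" "i \<notin> \<kappa> x" "i \<in> y \<longleftrightarrow> i \<in> x" by blast
      then show ?thesis
        using V X x yV by (intro subcube_vec_orthogonal_distance_vec) auto
    qed
    then have "0 = (\<Sum>x\<in>X. c x * (\<Sum>z\<in>Pow V. distance_vec N V y z * subcube_vec N (\<kappa> x) x z))"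
      by simp
    also have "\<dots> = (\<Sum>z\<in>Pow V. distance_vec N V y z * w z)"
      unfolding w_def sum_distrib_left by (subst sum.swap) (simp add: mult_ac)
    also have "\<dots> = (\<Sum>z\<in>Z. distance_vec N V y z * w z)"
      using V sub off by (intro sum.mono_neutral_right) auto
    finally show ?thesis by simp
  qed
  have dom: "(\<Sum>z\<in>Z - {y}. \<bar>distance_vec N V y z\<bar>) < \<bar>distance_vec N V y y\<bar>" if y: "y \<in> Z" for y
  proof -
    have N: "N > 0" by (simp add: N_def)
    have "N * (\<Sum>z\<in>Z - {y}. \<bar>distance_vec N V y z\<bar>) = (\<Sum>z\<in>Z - {y}. N * distance_vec N V y z)"
      using N by (simp add: sum_distrib_left distance_vec_def)
    also have "\<dots> \<le> (\<Sum>z\<in>Z - {y}. N ^ card V)"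
    proof (rule sum_mono)
      fix z assume z: "z \<in> Z - {y}"
      have sV: "sym_diff y z \<subseteq> V" using y z by (auto simp: Z_def)
      moreover have "sym_diff y z \<noteq> {}" using z by auto
      ultimately have "0 < card (sym_diff y z)" "card (sym_diff y z) \<le> card V"
        using V by (auto simp: card_gt_0_iff intro: finite_subset card_mono)
      then have "Suc (card V - card (sym_diff y z)) \<le> card V" by linarith
      then have "N ^ Suc (card V - card (sym_diff y z)) \<le> N ^ card V"
        using N by (intro power_increasing) auto
      then show "N * distance_vec N V y z \<le> N ^ card V" by (simp add: distance_vec_def)
    qed
    also have "\<dots> = int (card (Z - {y})) * N ^ card V" by simp
    also have "\<dots> \<le> 2 ^ card V * N ^ card V"
    proof -
      have "card (Z - {y}) \<le> card (Pow V)" using V sub by (intro card_mono) auto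
      then have "card (Z - {y}) \<le> 2 ^ card V" using V by (simp add: card_Pow)
      then have "int (card (Z - {y})) \<le> 2 ^ card V" by (metis of_nat_le_iff of_nat_numeral of_nat_power)
      then show ?thesis using N by (intro mult_right_mono) auto
    qed
    also have "\<dots> < N * N ^ card V"
      using N by (intro mult_strict_right_mono) (auto simp: N_def)
    finally show ?thesis using N by (simp add: distance_vec_def)
  qed
  have "w z = 0" if "z \<in> Z" for z
    by (rule diagonally_dominant_kernel_zero[OF fin(3) dom orth that])
  with off have w0: "w z = 0" if "z \<subseteq> V" for z
    using that by blast
  have "c y = 0" if "y \<in> X" for y
  proof (rule unit_mod_2_kernel_zero[OF fin(1), where m = "\<lambda>x. subcube_vec N (\<kappa> x) x"])
    show "odd (subcube_vec N (\<kappa> x) x x)" for x by (simp add: subcube_vec_def)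
    show "even (subcube_vec N (\<kappa> x) x y)" if "x \<in> X" "y \<in> X" "x \<noteq> y" for x y
    proof -
      have "sym_diff x y \<subseteq> V" "sym_diff x y \<noteq> {}" using X that by auto
      then have "0 < card (sym_diff x y)" using V by (auto simp: card_gt_0_iff intro: finite_subset)
      then show ?thesis by (simp add: subcube_vec_def N_def)
    qed
    show "(\<Sum>x\<in>X. c x * subcube_vec N (\<kappa> x) x y) = 0" if "y \<in> X" for y
      using w0[of y] X that by (auto simp: w_def)
  qed fact
  with c show False by blast
qed

section \<open>From sets to functions\<close>

lemma ennreal_layer_cake:
  fixes a :: ennreal
  shows "(\<integral>\<^sup>+s. indicator {s. 0 \<le> s \<and> ennreal s < a} s \<partial>lborel) = a"
proof (cases a)
  case (real r)
  then have "{s. 0 \<le> s \<and> ennreal s < a} = {0..<r}"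
    by (auto simp: ennreal_less_iff)
  then show ?thesis using real by simp
next
  case top
  have "of_nat k \<le> emeasure lborel {0 :: real..}" for k
  proof -
    have "emeasure lborel {0..real k} \<le> emeasure lborel {0 :: real..}"
      by (intro emeasure_mono) auto
    then show ?thesis by (simp add: ennreal_of_nat_eq_real_of_nat)
  qed
  then have "emeasure lborel {0 :: real..} = top"
    unfolding ennreal_SUP_of_nat_eq_top[symmetric] by (intro antisym SUP_least) (auto simp: ennreal_SUP_of_nat_eq_top)
  moreover have "{s. 0 \<le> s \<and> ennreal s < a} = {0..}"
    using top by auto
  ultimately show ?thesis using top by simp
qed

text \<open>
Summing \<open>u x * v x\<close> amounts to integrating over all pairs of thresholds the number of points at
which both are exceeded; a comparison of these counts therefore passes to the sums.
\<close>

lemma layer_cake_sum_product_mono: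
  fixes u v u' v' :: "'a \<Rightarrow> ennreal"
  assumes S: "finite S"
    and le: "\<And>s t. card {x\<in>S. s < u x \<and> t < v x} \<le> card {x\<in>S. s < u' x \<and> t < v' x}"
  shows "(\<Sum>x\<in>S. u x * v x) \<le> (\<Sum>x\<in>S. u' x * v' x)"
proof -
  define h :: "ennreal \<Rightarrow> real \<Rightarrow> ennreal" where "h a = indicator {s. 0 \<le> s \<and> ennreal s < a}" for a
  have [measurable]: "h a \<in> borel_measurable lborel" for a
    unfolding h_def by measurable
  have int: "(\<integral>\<^sup>+s. h a s \<partial>lborel) = a" for a
    unfolding h_def by (rule ennreal_layer_cake)
  have double: "(\<Sum>x\<in>S. p x * q x) = (\<integral>\<^sup>+s. \<integral>\<^sup>+t. (\<Sum>x\<in>S. h (p x) s * h (q x) t) \<partial>lborel \<partial>lborel)"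
    for p q :: "'a \<Rightarrow> ennreal"
    by (simp add: nn_integral_sum nn_integral_cmult nn_integral_multc int)
  have count: "(\<Sum>x\<in>S. h (p x) s * h (q x) t) =
      (if 0 \<le> s \<and> 0 \<le> t then of_nat (card {x\<in>S. ennreal s < p x \<and> ennreal t < q x}) else 0)"
    for p q :: "'a \<Rightarrow> ennreal" and s t
  proof -
    have "(\<Sum>x\<in>S. h (p x) s * h (q x) t) =
        (\<Sum>x\<in>S. if 0 \<le> s \<and> 0 \<le> t \<and> ennreal s < p x \<and> ennreal t < q x then 1 else 0)"
      by (intro sum.cong) (auto simp: h_def indicator_def)
    then show ?thesis
      using S by (auto simp: sum.If_cases Int_def)
  qed
  show ?thesis
    unfolding double[of u v] double[of u' v'] count
  proof (intro nn_integral_mono)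
    fix s t :: real
    have "(of_nat (card {x\<in>S. ennreal s < u x \<and> ennreal t < v x}) :: ennreal)
        \<le> of_nat (card {x\<in>S. ennreal s < u' x \<and> ennreal t < v' x})"
      using le[of "ennreal s" "ennreal t"] by (simp only: of_nat_le_iff)
    then show "(if 0 \<le> s \<and> 0 \<le> t then of_nat (card {x\<in>S. ennreal s < u x \<and> ennreal t < v x}) else 0 :: ennreal)
        \<le> (if 0 \<le> s \<and> 0 \<le> t then of_nat (card {x\<in>S. ennreal s < u' x \<and> ennreal t < v' x}) else 0)"
      by simp
  qed
qed

text \<open>
At each vertex a disjoint pair attains the maximum.  For given thresholds, the first set of the
pair certifies that \<open>F\<close> exceeds its threshold, and the second one, contained in the complement of
the first, certifies that \<open>G\<close> does; so the counts compare by \<open>reimer_butterfly\<close>.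
\<close>

lemma functional_reimer_cube:
  fixes F G :: "'a set \<Rightarrow> 'a set \<Rightarrow> ennreal"
  assumes V: "finite V"
    and F: "\<And>K x y. K \<subseteq> V \<Longrightarrow> x \<subseteq> V \<Longrightarrow> y \<subseteq> V \<Longrightarrow> x \<inter> K = y \<inter> K \<Longrightarrow> F K x = F K y"
    and G: "\<And>L x y. L \<subseteq> V \<Longrightarrow> x \<subseteq> V \<Longrightarrow> y \<subseteq> V \<Longrightarrow> x \<inter> L = y \<inter> L \<Longrightarrow> G L x = G L y"
  shows "(\<Sum>x\<in>Pow V. SUP (K, L)\<in>{(K, L). K \<subseteq> V \<and> L \<subseteq> V \<and> K \<inter> L = {}}. F K x * G L x)
    \<le> (\<Sum>x\<in>Pow V. (SUP K\<in>Pow V. F K x) * (SUP L\<in>Pow V. G L (V - x)))"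
proof -
  define D where "D = {(K, L). K \<subseteq> V \<and> L \<subseteq> V \<and> K \<inter> L = {}}"
  have "D \<subseteq> Pow V \<times> Pow V" "({}, {}) \<in> D" by (auto simp: D_def)
  then have D: "finite D" "D \<noteq> {}"
    using finite_subset[of D "Pow V \<times> Pow V"] V by blast+
  have "\<exists>p\<in>D. (SUP (K, L)\<in>D. F K x * G L x) = F (fst p) x * G (snd p) x" for x
  proof -
    let ?I = "(\<lambda>(K, L). F K x * G L x) ` D"
    have "Sup ?I \<in> ?I"
      using D by (subst cSup_eq_Max) (auto intro!: Max_in)
    then show ?thesis by (auto simp: split_beta)
  qed
  then obtain p where p: "\<And>x. p x \<in> D"
    "\<And>x. (SUP (K, L)\<in>D. F K x * G L x) = F (fst (p x)) x * G (snd (p x)) x"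
    by metis
  have pV: "fst (p x) \<subseteq> V" "snd (p x) \<subseteq> V - fst (p x)" for x
    using p(1)[of x] by (auto simp: D_def)
  have "(\<Sum>x\<in>Pow V. F (fst (p x)) x * G (snd (p x)) x)
    \<le> (\<Sum>x\<in>Pow V. (SUP K\<in>Pow V. F K x) * (SUP L\<in>Pow V. G L (V - x)))"
  proof (rule layer_cake_sum_product_mono)
    fix s t :: ennreal
    let ?X = "{x \<in> Pow V. s < F (fst (p x)) x \<and> t < G (snd (p x)) x}"
    let ?A = "{y. s < (SUP K\<in>Pow V. F K y)}" and ?B = "{y. t < (SUP L\<in>Pow V. G L y)}"
    have "card ?X \<le> card {y. y \<subseteq> V \<and> y \<in> ?A \<and> V - y \<in> ?B}"
    proof (rule reimer_butterfly[where \<kappa> = "\<lambda>x. fst (p x)"])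
      fix x y assume x: "x \<in> ?X" and y: "y \<subseteq> V" "y \<inter> fst (p x) = x \<inter> fst (p x)"
      have "F (fst (p x)) y = F (fst (p x)) x"
        using x y pV(1)[of x] by (intro F) auto
      with x have "s < F (fst (p x)) y" by simp
      then show "y \<in> ?A" using pV(1)[of x] by (auto simp: less_SUP_iff)
    next
      fix x y assume x: "x \<in> ?X" and y: "y \<subseteq> V" "y \<inter> (V - fst (p x)) = x \<inter> (V - fst (p x))"
      have "y \<inter> snd (p x) = x \<inter> snd (p x)" using y pV(2)[of x] by blast
      then have "G (snd (p x)) y = G (snd (p x)) x"
        using x y pV(2)[of x] by (intro G) auto
      with x have "t < G (snd (p x)) y" by simp
      then show "y \<in> ?B" using pV(2)[of x] by (auto simp: less_SUP_iff)
    qed (use V in auto)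
    then show "card ?X \<le> card {x \<in> Pow V. s < (SUP K\<in>Pow V. F K x) \<and> t < (SUP L\<in>Pow V. G L (V - x))}"
      by simp
  qed (use V in simp)
  then show ?thesis unfolding D_def[symmetric] p(2) .
qed

section \<open>From the cube to product spaces\<close>

text \<open>
Two independent copies of a point are encoded as one point \<open>\<omega>\<close> indexed by \<open>V \<times> bool\<close>, and a vertex
\<open>T\<close> of the cube selects one of the two copies at each coordinate.  The selections made by \<open>T\<close> and by
\<open>V - T\<close> have no entry in common.
\<close>

definition pick :: "'i set \<Rightarrow> 'i set \<Rightarrow> ('i \<times> bool \<Rightarrow> 'a) \<Rightarrow> 'i \<Rightarrow> 'a" where
  "pick V T \<omega> = (\<lambda>i\<in>V. \<omega> (i, i \<in> T))"

lemma measurable_pick: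
  assumes "(\<lambda>i. (i, i \<in> T)) ` V \<subseteq> I"
  shows "pick V T \<in> (\<Pi>\<^sub>M j\<in>I. M (fst j)) \<rightarrow>\<^sub>M (\<Pi>\<^sub>M i\<in>V. M i)"
  unfolding pick_def
proof (rule measurable_restrict)
  fix i assume "i \<in> V"
  then have "(i, i \<in> T) \<in> I" using assms by blast
  from measurable_component_singleton[OF this, of "\<lambda>j. M (fst j)"]
  show "(\<lambda>\<omega>. \<omega> (i, i \<in> T)) \<in> (\<Pi>\<^sub>M j\<in>I. M (fst j)) \<rightarrow>\<^sub>M M i"
    by (simp only: fst_conv)
qed

lemma nn_integral_pick:
  assumes M: "\<And>i. prob_space (M i)"
    and I: "(\<lambda>i. (i, i \<in> T)) ` V \<subseteq> I"
    and h: "h \<in> borel_measurable (\<Pi>\<^sub>M i\<in>V. M i)"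
  shows "(\<integral>\<^sup>+\<omega>. h (pick V T \<omega>) \<partial>(\<Pi>\<^sub>M j\<in>I. M (fst j))) = (\<integral>\<^sup>+x. h x \<partial>(\<Pi>\<^sub>M i\<in>V. M i))"
proof -
  have "distr (\<Pi>\<^sub>M j\<in>I. M (fst j)) (\<Pi>\<^sub>M i\<in>V. M (fst (i, i \<in> T))) (\<lambda>\<omega>. \<lambda>i\<in>V. \<omega> (i, i \<in> T))
      = (\<Pi>\<^sub>M i\<in>V. M (fst (i, i \<in> T)))"
    using I M by (intro distr_PiM_reindex) (auto simp: inj_on_def)
  then have "distr (\<Pi>\<^sub>M j\<in>I. M (fst j)) (\<Pi>\<^sub>M i\<in>V. M i) (pick V T) = (\<Pi>\<^sub>M i\<in>V. M i)"
    by (simp add: pick_def[abs_def])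
  then show ?thesis
    using nn_integral_distr[OF measurable_pick[OF I, of M], of h] h by simp
qed

lemma nn_integral_pick_complementary:
  assumes M: "\<And>i. prob_space (M i)" and V: "finite V"
    and [measurable]: "f \<in> borel_measurable (\<Pi>\<^sub>M i\<in>V. M i)" "g \<in> borel_measurable (\<Pi>\<^sub>M i\<in>V. M i)"
  shows "(\<integral>\<^sup>+\<omega>. f (pick V T \<omega>) * g (pick V (V - T) \<omega>) \<partial>(\<Pi>\<^sub>M j\<in>V \<times> UNIV. M (fst j)))
    = (\<integral>\<^sup>+x. f x \<partial>(\<Pi>\<^sub>M i\<in>V. M i)) * (\<integral>\<^sup>+x. g x \<partial>(\<Pi>\<^sub>M i\<in>V. M i))"
proof -
  interpret M: product_sigma_finite "\<lambda>j :: _ \<times> bool. M (fst j)"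
    unfolding product_sigma_finite_def using M prob_space_imp_sigma_finite by blast
  define I J where "I = (\<lambda>i. (i, i \<in> T)) ` V" and "J = (\<lambda>i. (i, i \<in> V - T)) ` V"
  have IJ: "I \<inter> J = {}" "finite I" "finite J" "V \<times> UNIV = I \<union> J"
    using V by (auto simp: I_def J_def image_iff)
  have [measurable]: "pick V T \<in> (\<Pi>\<^sub>M j\<in>I \<union> J. M (fst j)) \<rightarrow>\<^sub>M (\<Pi>\<^sub>M i\<in>V. M i)"
    "pick V (V - T) \<in> (\<Pi>\<^sub>M j\<in>I \<union> J. M (fst j)) \<rightarrow>\<^sub>M (\<Pi>\<^sub>M i\<in>V. M i)"
    "pick V T \<in> (\<Pi>\<^sub>M j\<in>I. M (fst j)) \<rightarrow>\<^sub>M (\<Pi>\<^sub>M i\<in>V. M i)"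
    "pick V (V - T) \<in> (\<Pi>\<^sub>M j\<in>J. M (fst j)) \<rightarrow>\<^sub>M (\<Pi>\<^sub>M i\<in>V. M i)"
    by (rule measurable_pick, force simp: I_def J_def)+
  have "pick V T (merge I J (x, y)) = pick V T x" for x y :: "_ \<times> bool \<Rightarrow> 'b"
    by (auto simp: pick_def merge_def I_def fun_eq_iff restrict_def)
  moreover have "pick V (V - T) (merge I J (x, y)) = pick V (V - T) y" for x y :: "_ \<times> bool \<Rightarrow> 'b"
    by (auto simp: pick_def merge_def I_def J_def fun_eq_iff restrict_def)
  moreover have "(\<lambda>\<omega>. f (pick V T \<omega>) * g (pick V (V - T) \<omega>))
      \<in> borel_measurable (\<Pi>\<^sub>M j\<in>I \<union> J. M (fst j))"
    by measurable
  ultimately have "(\<integral>\<^sup>+\<omega>. f (pick V T \<omega>) * g (pick V (V - T) \<omega>) \<partial>(\<Pi>\<^sub>M j\<in>V \<times> UNIV. M (fst j)))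
    = (\<integral>\<^sup>+x. \<integral>\<^sup>+y. f (pick V T x) * g (pick V (V - T) y) \<partial>(\<Pi>\<^sub>M j\<in>J. M (fst j)) \<partial>(\<Pi>\<^sub>M j\<in>I. M (fst j)))"
    unfolding IJ(4) by (simp add: M.product_nn_integral_fold[OF IJ(1-3)])
  also have "\<dots> = (\<integral>\<^sup>+x. f (pick V T x) \<partial>(\<Pi>\<^sub>M j\<in>I. M (fst j))) *
      (\<integral>\<^sup>+y. g (pick V (V - T) y) \<partial>(\<Pi>\<^sub>M j\<in>J. M (fst j)))"
    by (simp add: nn_integral_cmult nn_integral_multc)
  also have "\<dots> = (\<integral>\<^sup>+x. f x \<partial>(\<Pi>\<^sub>M i\<in>V. M i)) * (\<integral>\<^sup>+x. g x \<partial>(\<Pi>\<^sub>M i\<in>V. M i))"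
    using nn_integral_pick[of M T V I f, OF M] nn_integral_pick[of M "V - T" V J g, OF M]
    by (simp add: I_def J_def)
  finally show ?thesis .
qed

text \<open>
The Boolean cube enters by symmetrization.  For each \<open>T\<close>, the point \<open>pick V T \<omega>\<close> has the given
law and is independent of \<open>pick V (V - T) \<omega>\<close>, so both sides of the claim may be averaged over \<open>T\<close>.
For fixed \<open>\<omega>\<close> the average over \<open>T\<close> is a sum over the cube, on which \<open>F K (pick V T \<omega>)\<close> depends only
on \<open>T \<inter> K\<close>, and \<open>functional_reimer_cube\<close> applies.
\<close>

proposition functional_bkr:
  fixes M :: "'i \<Rightarrow> 'a measure" and F G :: "'i set \<Rightarrow> ('i \<Rightarrow> 'a) \<Rightarrow> ennreal"
  assumes V: "finite V" and M: "\<And>i. prob_space (M i)"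
    and F: "\<And>K. K \<subseteq> V \<Longrightarrow> F K \<in> borel_measurable (\<Pi>\<^sub>M i\<in>V. M i)"
      "\<And>K. K \<subseteq> V \<Longrightarrow> depends_on (space (\<Pi>\<^sub>M i\<in>V. M i)) (F K) K"
    and G: "\<And>L. L \<subseteq> V \<Longrightarrow> G L \<in> borel_measurable (\<Pi>\<^sub>M i\<in>V. M i)"
      "\<And>L. L \<subseteq> V \<Longrightarrow> depends_on (space (\<Pi>\<^sub>M i\<in>V. M i)) (G L) L"
  shows "(\<integral>\<^sup>+x. (SUP (K, L)\<in>{(K, L). K \<subseteq> V \<and> L \<subseteq> V \<and> K \<inter> L = {}}. F K x * G L x) \<partial>(\<Pi>\<^sub>M i\<in>V. M i))
    \<le> (\<integral>\<^sup>+x. (SUP K\<in>Pow V. F K x) \<partial>(\<Pi>\<^sub>M i\<in>V. M i)) * (\<integral>\<^sup>+x. (SUP L\<in>Pow V. G L x) \<partial>(\<Pi>\<^sub>M i\<in>V. M i))"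
    (is "integral\<^sup>N ?P ?H \<le> integral\<^sup>N ?P ?F * integral\<^sup>N ?P ?G")
proof -
  let ?D = "{(K, L). K \<subseteq> V \<and> L \<subseteq> V \<and> K \<inter> L = {}}"
  let ?Q = "\<Pi>\<^sub>M j\<in>V \<times> (UNIV :: bool set). M (fst j)"
  have "?D \<subseteq> Pow V \<times> Pow V" by auto
  then have D: "countable ?D"
    using V by (meson countable_finite finite_Pow_iff finite_SigmaI finite_subset)
  have PowV: "countable (Pow V)" using V by (simp add: countable_finite)
  have meas: "?H \<in> borel_measurable ?P" "?F \<in> borel_measurable ?P" "?G \<in> borel_measurable ?P"
    by (intro borel_measurable_SUP D PowV; use F(1) G(1) in auto)+
  have [measurable]: "pick V T \<in> ?Q \<rightarrow>\<^sub>M ?P" for T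
    by (rule measurable_pick) auto
  note [measurable] = meas
  have space: "pick V T \<omega> \<in> space ?P" if "\<omega> \<in> space ?Q" for T \<omega>
    using that by (rule measurable_space[rotated]) measurable
  have cube: "(\<Sum>T\<in>Pow V. ?H (pick V T \<omega>)) \<le> (\<Sum>T\<in>Pow V. ?F (pick V T \<omega>) * ?G (pick V (V - T) \<omega>))"
    if \<omega>: "\<omega> \<in> space ?Q" for \<omega>
  proof (rule functional_reimer_cube[OF V])
    have agree: "restrict (pick V x \<omega>) K = restrict (pick V y \<omega>) K" if "x \<inter> K = y \<inter> K" for x y K
    proof -
      have "(i \<in> x) = (i \<in> y)" if "i \<in> K" for i
        using that \<open>x \<inter> K = y \<inter> K\<close> by blast
      then show ?thesis
        unfolding pick_def by (intro restrict_ext) simp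
    qed
    show "F K (pick V x \<omega>) = F K (pick V y \<omega>)" if "K \<subseteq> V" "x \<inter> K = y \<inter> K" for K x y
      by (rule F(2)[OF that(1), unfolded depends_on_def, rule_format, OF space[OF \<omega>] space[OF \<omega>] agree[OF that(2)]])
    show "G K (pick V x \<omega>) = G K (pick V y \<omega>)" if "K \<subseteq> V" "x \<inter> K = y \<inter> K" for K x y
      by (rule G(2)[OF that(1), unfolded depends_on_def, rule_format, OF space[OF \<omega>] space[OF \<omega>] agree[OF that(2)]])
  qed
  have "2 ^ card V * integral\<^sup>N ?P ?H = (\<Sum>T\<in>Pow V. \<integral>\<^sup>+\<omega>. ?H (pick V T \<omega>) \<partial>?Q)"
  proof -
    have "(\<integral>\<^sup>+\<omega>. ?H (pick V T \<omega>) \<partial>?Q) = integral\<^sup>N ?P ?H" for T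
      by (rule nn_integral_pick[OF M _ meas(1)]) auto
    then show ?thesis using V by (simp only: sum_constant card_Pow of_nat_power of_nat_numeral)
  qed
  also have "\<dots> = (\<integral>\<^sup>+\<omega>. (\<Sum>T\<in>Pow V. ?H (pick V T \<omega>)) \<partial>?Q)"
    by (rule nn_integral_sum[symmetric]) measurable
  also have "\<dots> \<le> (\<integral>\<^sup>+\<omega>. (\<Sum>T\<in>Pow V. ?F (pick V T \<omega>) * ?G (pick V (V - T) \<omega>)) \<partial>?Q)"
    by (rule nn_integral_mono) (rule cube)
  also have "\<dots> = (\<Sum>T\<in>Pow V. \<integral>\<^sup>+\<omega>. ?F (pick V T \<omega>) * ?G (pick V (V - T) \<omega>) \<partial>?Q)"
    by (rule nn_integral_sum) measurable
  also have "\<dots> = 2 ^ card V * (integral\<^sup>N ?P ?F * integral\<^sup>N ?P ?G)"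
    using V by (simp only: nn_integral_pick_complementary[OF M V meas(2,3)] sum_constant card_Pow
      of_nat_power of_nat_numeral)
  finally have *: "2 ^ card V * integral\<^sup>N ?P ?H \<le> 2 ^ card V * (integral\<^sup>N ?P ?F * integral\<^sup>N ?P ?G)" .
  have two: "(2 :: ennreal) ^ card V \<noteq> 0" "(2 :: ennreal) ^ card V \<noteq> top"
    by (simp_all add: power_eq_top_ennreal)
  show ?thesis
    by (rule iffD1[OF ennreal_mult_le_mult_iff[OF two] *])
qed

section \<open>Lower functions\<close>

text \<open>
The supremum defining the essential infimum is attained, being the supremum of a sequence.
\<close>

lemma AE_ess_inf_le: "AE z in M. ess_inf M f \<le> f z"
proof -
  have "{c. AE z in M. c \<le> f z} \<noteq> {}" by (auto intro!: exI[of _ 0])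
  then obtain c :: "nat \<Rightarrow> ennreal" where c: "range c \<subseteq> {c. AE z in M. c \<le> f z}"
    "Sup {c. AE z in M. c \<le> f z} = (SUP k. c k)"
    using ennreal_Sup_countable_SUP by meson
  then have "AE z in M. \<forall>k. c k \<le> f z"
    by (auto simp: AE_all_countable)
  then show ?thesis
    unfolding ess_inf_def c(2) by eventually_elim (auto intro: SUP_least)
qed

text \<open>
Rational thresholds turn the superlevel sets of an essential infimum that depends on a parameter
into countable unions, which is how it is seen to be measurable in the parameter.
\<close>

lemma less_ess_inf_iff:
  "y < ess_inf M f \<longleftrightarrow> (\<exists>r :: rat. y < ennreal (real_of_rat r) \<and> (AE z in M. ennreal (real_of_rat r) \<le> f z))"
proof
  assume "y < ess_inf M f"
  then obtain c where c: "AE z in M. c \<le> f z" "y < c"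
    by (auto simp: ess_inf_def less_Sup_iff)
  then obtain r :: rat where r: "y < real_of_rat r" "real_of_rat r < c"
    using ennreal_rat_dense by blast
  have "AE z in M. ennreal (real_of_rat r) \<le> f z"
    using c(1) by eventually_elim (use r in auto)
  with r show "\<exists>r :: rat. y < ennreal (real_of_rat r) \<and> (AE z in M. ennreal (real_of_rat r) \<le> f z)"
    by blast
next
  assume "\<exists>r :: rat. y < ennreal (real_of_rat r) \<and> (AE z in M. ennreal (real_of_rat r) \<le> f z)"
  then show "y < ess_inf M f"
    unfolding ess_inf_def by (auto intro: less_le_trans Sup_upper)
qed

lemma borel_measurable_ess_inf:
  assumes "sigma_finite_measure N"
    and [measurable]: "(\<lambda>(x, z). h x z) \<in> borel_measurable (M \<Otimes>\<^sub>M N)"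
  shows "(\<lambda>x. ess_inf N (h x)) \<in> borel_measurable M"
proof (rule borel_measurableI_greater)
  interpret sigma_finite_measure N by fact
  fix y
  have AE: "(AE z in N. c \<le> h x z) \<longleftrightarrow> (\<integral>\<^sup>+z. (if c \<le> h x z then 0 else 1) \<partial>N) = 0"
    if [measurable]: "x \<in> space M" for c x
    by (subst nn_integral_0_iff_AE) (auto intro!: AE_cong)
  have "{x \<in> space M. y < ess_inf N (h x)} = {x \<in> space M. \<exists>r :: rat. y < ennreal (real_of_rat r) \<and>
      (\<integral>\<^sup>+z. (if ennreal (real_of_rat r) \<le> h x z then 0 else 1) \<partial>N) = 0}"
    by (auto simp: less_ess_inf_iff AE)
  also have "\<dots> \<in> sets M" by measurable
  finally show "{x \<in> space M. y < ess_inf N (h x)} \<in> sets M" .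
qed

lemma merge_measurable_overwrite:
  assumes "K \<subseteq> V"
  shows "merge K (V - K) \<in> (\<Pi>\<^sub>M i\<in>V. M i) \<Otimes>\<^sub>M (\<Pi>\<^sub>M i\<in>V - K. M i) \<rightarrow>\<^sub>M (\<Pi>\<^sub>M i\<in>V. M i)"
proof -
  have V: "K \<union> (V - K) = V" using assms by auto
  have [measurable]: "(\<lambda>x. restrict x K) \<in> (\<Pi>\<^sub>M i\<in>V. M i) \<rightarrow>\<^sub>M (\<Pi>\<^sub>M i\<in>K. M i)"
    by (rule measurable_restrict_subset[OF assms])
  have "(\<lambda>p. merge K (V - K) (restrict (fst p) K, snd p))
      \<in> (\<Pi>\<^sub>M i\<in>V. M i) \<Otimes>\<^sub>M (\<Pi>\<^sub>M i\<in>V - K. M i) \<rightarrow>\<^sub>M (\<Pi>\<^sub>M i\<in>K \<union> (V - K). M i)"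
    by measurable
  then show ?thesis unfolding V by simp
qed

lemma lower_fun_depends_on:
  fixes f :: "(nat \<Rightarrow> 'a) \<Rightarrow> real"
  shows "depends_on \<Omega> (lower_fun n S P f K) K"
  unfolding depends_on_def lower_fun_def
proof (intro ballI impI)
  fix x y :: "nat \<Rightarrow> 'a"
  assume "restrict x K = restrict y K"
  then have "merge K J (x, z) = merge K J (y, z)" for J and z :: "nat \<Rightarrow> 'a"
    by (metis merge_restrict(1))
  then show "ess_inf (marginal S P ({1..n} - K)) (\<lambda>z. ennreal (f (merge K ({1..n} - K) (x, z)))) =
      ess_inf (marginal S P ({1..n} - K)) (\<lambda>z. ennreal (f (merge K ({1..n} - K) (y, z))))"
    by (simp only:)
qed

context
  fixes n :: nat and S M :: "nat \<Rightarrow> 'a measure" and f :: "(nat \<Rightarrow> 'a) \<Rightarrow> real" and K :: "nat set"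
  assumes M: "\<And>i. prob_space (M i)"
    and sets_M: "\<And>i. i \<in> {1..n} \<Longrightarrow> sets (M i) = sets (S i)"
    and f: "f \<in> borel_measurable (\<Pi>\<^sub>M i\<in>{1..n}. M i)"
    and K: "K \<subseteq> {1..n}"
begin

interpretation product_prob_space M by (intro product_prob_spaceI M)

lemma marginal_PiM:
  assumes "J \<subseteq> {1..n}"
  shows "marginal S (\<Pi>\<^sub>M i\<in>{1..n}. M i) J = (\<Pi>\<^sub>M i\<in>J. M i)"
proof -
  have "sets (\<Pi>\<^sub>M i\<in>J. S i) = sets (\<Pi>\<^sub>M i\<in>J. M i)"
    using assms sets_M by (intro sets_PiM_cong) auto
  then have "marginal S (\<Pi>\<^sub>M i\<in>{1..n}. M i) J =
      distr (\<Pi>\<^sub>M i\<in>{1..n}. M i) (\<Pi>\<^sub>M i\<in>J. M i) (\<lambda>x. restrict x J)"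
    unfolding marginal_def by (intro distr_cong) auto
  then show ?thesis
    using distr_restrict[OF assms] by simp
qed

lemma lower_fun_PiM: "lower_fun n S (\<Pi>\<^sub>M i\<in>{1..n}. M i) f K x =
    ess_inf (\<Pi>\<^sub>M i\<in>{1..n} - K. M i) (\<lambda>z. ennreal (f (merge K ({1..n} - K) (x, z))))"
  by (simp only: lower_fun_def marginal_PiM[OF Diff_subset])

lemma borel_measurable_lower_fun:
  "lower_fun n S (\<Pi>\<^sub>M i\<in>{1..n}. M i) f K \<in> borel_measurable (\<Pi>\<^sub>M i\<in>{1..n}. M i)"
  unfolding lower_fun_PiM[abs_def]
proof (rule borel_measurable_ess_inf)
  show "sigma_finite_measure (\<Pi>\<^sub>M i\<in>{1..n} - K. M i)"
    by (intro prob_space_imp_sigma_finite prob_space_PiM M)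
  show "(\<lambda>(x, z). ennreal (f (merge K ({1..n} - K) (x, z))))
      \<in> borel_measurable ((\<Pi>\<^sub>M i\<in>{1..n}. M i) \<Otimes>\<^sub>M (\<Pi>\<^sub>M i\<in>{1..n} - K. M i))"
    using measurable_compose[OF merge_measurable_overwrite[OF K] measurable_compose[OF f measurable_ennreal]]
    by (simp add: split_beta')
qed

text \<open>
On the set of points that agree with \<open>a\<close> on \<open>K\<close>, the function \<open>lower_fun\<close> is constant, and this
constant is at most \<open>f\<close> almost everywhere on that set; Fubini's theorem integrates the exceptional
null sets.
\<close>

lemma AE_lower_fun_le:
  "AE x in (\<Pi>\<^sub>M i\<in>{1..n}. M i). lower_fun n S (\<Pi>\<^sub>M i\<in>{1..n}. M i) f K x \<le> ennreal (f x)"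
proof -
  let ?V = "{1..n}" and ?P = "\<Pi>\<^sub>M i\<in>{1..n}. M i"
  let ?A = "\<Pi>\<^sub>M i\<in>K. M i" and ?B = "\<Pi>\<^sub>M i\<in>?V - K. M i"
  let ?F = "lower_fun n S ?P f K"
  interpret AB: pair_sigma_finite ?A ?B
    unfolding pair_sigma_finite_def by (intro conjI prob_space_imp_sigma_finite prob_space_PiM M)
  have V: "K \<union> (?V - K) = ?V" using K by auto
  have P: "?P = distr (?A \<Otimes>\<^sub>M ?B) ?P (merge K (?V - K))"
    using distr_merge[of K "?V - K", OF Diff_disjoint finite_subset[OF K] finite_Diff]
    by (simp only: V finite_atLeastAtMost)
  have merge [measurable]: "merge K (?V - K) \<in> ?A \<Otimes>\<^sub>M ?B \<rightarrow>\<^sub>M ?P"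
    using measurable_merge[of K "?V - K" M] by (simp only: V)
  note [measurable] = f borel_measurable_lower_fun
  have "AE a in ?A. AE z in ?B. ?F (merge K (?V - K) (a, z)) \<le> ennreal (f (merge K (?V - K) (a, z)))"
  proof (rule AE_I2)
    fix a :: "nat \<Rightarrow> 'a"
    have "merge K (?V - K) (merge K (?V - K) (a, z), z') = merge K (?V - K) (a, z')" for z z' :: "nat \<Rightarrow> 'a"
      by (auto simp: merge_def fun_eq_iff)
    then show "AE z in ?B. ?F (merge K (?V - K) (a, z)) \<le> ennreal (f (merge K (?V - K) (a, z)))"
      unfolding lower_fun_PiM by (simp only: AE_ess_inf_le)
  qed
  then have "AE p in ?A \<Otimes>\<^sub>M ?B. ?F (merge K (?V - K) p) \<le> ennreal (f (merge K (?V - K) p))"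
    by (intro AB.AE_pair_measure) measurable
  then have "AE x in distr (?A \<Otimes>\<^sub>M ?B) ?P (merge K (?V - K)). ?F x \<le> ennreal (f x)"
    by (subst AE_distr_iff) measurable
  then show ?thesis
    by (simp only: P[symmetric])
qed

end

section \<open>Suprema within a set of coordinates\<close>

lemma sup_within_depends_on:
  assumes "dependent_family n S A f K"
  shows "depends_on (space (\<Pi>\<^sub>M i\<in>{1..n}. S i)) (sup_within A f K I) I"
  unfolding depends_on_def
proof (intro ballI impI)
  fix x y assume xy: "x \<in> space (\<Pi>\<^sub>M i\<in>{1..n}. S i)" "y \<in> space (\<Pi>\<^sub>M i\<in>{1..n}. S i)"
    and eq: "restrict x I = restrict y I"
  have "f \<alpha> x = f \<alpha> y" if \<alpha>: "\<alpha> \<in> A" "K \<alpha> \<subseteq> I" for \<alpha>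
  proof -
    have "restrict x (K \<alpha>) = restrict y (K \<alpha>)"
      using eq \<alpha>(2) by (metis Int_absorb1 restrict_restrict)
    then show ?thesis
      using assms \<alpha>(1) xy unfolding dependent_family_def depends_on_def by blast
  qed
  then show "sup_within A f K I x = sup_within A f K I y"
    unfolding sup_within_def by (intro SUP_cong) auto
qed

lemma borel_measurable_sup_within:
  assumes "dependent_family n S A f K"
  shows "sup_within A f K I \<in> borel_measurable (\<Pi>\<^sub>M i\<in>{1..n}. S i)"
  unfolding sup_within_def[abs_def]
  using assms by (intro borel_measurable_SUP) (auto simp: dependent_family_def)

section \<open>The three inequalities\<close>

theorem proposition1p1:
  fixes n :: nat
    and S :: "nat \<Rightarrow> 'a measure"
    and \<Omega> :: "'w measure"
    and X :: "'w \<Rightarrow> nat \<Rightarrow> 'a"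
    and P :: "(nat \<Rightarrow> 'a) measure"
  assumes "n \<ge> 1"
    and "prob_space \<Omega>"
    and "X \<in> \<Omega> \<rightarrow>\<^sub>M (\<Pi>\<^sub>M i\<in>{1..n}. S i)"
    and "P = distr \<Omega> (\<Pi>\<^sub>M i\<in>{1..n}. S i) X"
    and "prob_space.indep_vars \<Omega> S (\<lambda>i \<omega>. X \<omega> i) {1..n}"
  shows
    "(\<forall>(A :: 'k set) (B :: 'l set) f g K L.
        dependent_family n S A f K \<and> dependent_family n S B g L \<longrightarrow>
        (\<integral>\<^sup>+\<omega>. (SUP (I, J)\<in>{(I, J). I \<in> K ` A \<and> J \<in> L ` B \<and> I \<inter> J = {}}.
                   sup_within A f K I (X \<omega>) * sup_within B g L J (X \<omega>)) \<partial>\<Omega>)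
          \<le> (\<integral>\<^sup>+\<omega>. (SUP \<alpha>\<in>A. ennreal (f \<alpha> (X \<omega>))) \<partial>\<Omega>) *
            (\<integral>\<^sup>+\<omega>. (SUP \<beta>\<in>B. ennreal (g \<beta> (X \<omega>))) \<partial>\<Omega>) \<and>
        (\<forall>\<kappa> \<mu>. disjoint_choice n S (K ` A) (L ` B) \<kappa> \<mu> \<longrightarrow>
          (\<integral>\<^sup>+\<omega>. sup_within A f K (\<kappa> (X \<omega>)) (X \<omega>) * sup_within B g L (\<mu> (X \<omega>)) (X \<omega>) \<partial>\<Omega>)
            \<le> (\<integral>\<^sup>+\<omega>. (SUP \<alpha>\<in>A. ennreal (f \<alpha> (X \<omega>))) \<partial>\<Omega>) *
              (\<integral>\<^sup>+\<omega>. (SUP \<beta>\<in>B. ennreal (g \<beta> (X \<omega>))) \<partial>\<Omega>))) \<and>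
     (\<forall>f g \<K> \<L>.
        f \<in> borel_measurable (\<Pi>\<^sub>M i\<in>{1..n}. S i) \<and>
        g \<in> borel_measurable (\<Pi>\<^sub>M i\<in>{1..n}. S i) \<and>
        (\<forall>x\<in>space (\<Pi>\<^sub>M i\<in>{1..n}. S i). 0 \<le> f x \<and> 0 \<le> g x) \<and>
        \<K> \<subseteq> Pow {1..n} \<and> \<L> \<subseteq> Pow {1..n} \<longrightarrow>
        (\<forall>\<kappa> \<mu>. disjoint_choice n S \<K> \<L> \<kappa> \<mu> \<longrightarrow>
          (\<integral>\<^sup>+\<omega>. lower_fun n S P f (\<kappa> (X \<omega>)) (X \<omega>) * lower_fun n S P g (\<mu> (X \<omega>)) (X \<omega>) \<partial>\<Omega>)
            \<le> (\<integral>\<^sup>+\<omega>. ennreal (f (X \<omega>)) \<partial>\<Omega>) * (\<integral>\<^sup>+\<omega>. ennreal (g (X \<omega>)) \<partial>\<Omega>)))"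
proof -
  let ?V = "{1..n}" and ?S = "\<Pi>\<^sub>M i\<in>{1..n}. S i"
  let ?D = "{(I, J). I \<subseteq> {1..n} \<and> J \<subseteq> {1..n} \<and> I \<inter> J = {}}"
  note X = assms(3)
  interpret \<Omega>: prob_space \<Omega> by fact
  have Xi: "(\<lambda>\<omega>. X \<omega> i) \<in> \<Omega> \<rightarrow>\<^sub>M S i" if "i \<in> ?V" for i
    using measurable_compose[OF X measurable_component_singleton[OF that]] .
  \<comment> \<open>\<open>functional_bkr\<close> wants a probability space at every index; outside \<open>{1..n}\<close> the law of
    \<open>X\<^sub>1\<close> serves as a dummy, which exists because \<open>n \<ge> 1\<close>.\<close>
  define M where "M i = (let j = if i \<in> ?V then i else 1 in distr \<Omega> (S j) (\<lambda>\<omega>. X \<omega> j))" for i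
  have M: "prob_space (M i)" for i
  proof -
    have "(if i \<in> ?V then i else 1) \<in> ?V" using \<open>n \<ge> 1\<close> by auto
    from \<Omega>.prob_space_distr[OF Xi[OF this]] show ?thesis by (simp only: M_def Let_def)
  qed
  have M_eq: "M i = distr \<Omega> (S i) (\<lambda>\<omega>. X \<omega> i)" if "i \<in> ?V" for i
    using that by (simp only: M_def Let_def if_True)
  have sets_M: "sets (M i) = sets (S i)" if "i \<in> ?V" for i
    by (simp only: M_eq[OF that] sets_distr)
  have sets_PiM: "sets (\<Pi>\<^sub>M i\<in>?V. M i) = sets ?S"
    by (rule sets_PiM_cong[OF refl sets_M])
  have space_M: "space (\<Pi>\<^sub>M i\<in>?V. M i) = space ?S"
    by (rule sets_eq_imp_space_eq[OF sets_PiM])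
  have meas_PiM: "borel_measurable (\<Pi>\<^sub>M i\<in>?V. M i) = (borel_measurable ?S :: ((nat \<Rightarrow> 'a) \<Rightarrow> 'b :: topological_space) set)"
    by (rule measurable_cong_sets[OF sets_PiM refl])
  have "?V \<noteq> {}" using \<open>n \<ge> 1\<close> by auto
  have "P = distr \<Omega> ?S (\<lambda>\<omega>. \<lambda>i\<in>?V. X \<omega> i)"
    unfolding assms(4)
  proof (rule distr_cong[OF refl refl])
    fix \<omega> assume "\<omega> \<in> space \<Omega>"
    then have "X \<omega> \<in> space ?S" by (rule measurable_space[OF X])
    then show "X \<omega> = (\<lambda>i\<in>?V. X \<omega> i)"
      by (simp only: Finite_Product_Measure.space_PiM PiE_restrict)
  qed
  also have "\<dots> = (\<Pi>\<^sub>M i\<in>?V. distr \<Omega> (S i) (\<lambda>\<omega>. X \<omega> i))"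
    by (rule iffD1[OF \<Omega>.indep_vars_iff_distr_eq_PiM' assms(5)]) (fact \<open>?V \<noteq> {}\<close>, rule Xi)
  also have "\<dots> = (\<Pi>\<^sub>M i\<in>?V. M i)"
    by (rule PiM_cong[OF refl M_eq[symmetric]])
  finally have P: "P = (\<Pi>\<^sub>M i\<in>?V. M i)" .
  have law: "(\<integral>\<^sup>+\<omega>. h (X \<omega>) \<partial>\<Omega>) = (\<integral>\<^sup>+x. h x \<partial>(\<Pi>\<^sub>M i\<in>?V. M i))"
    if "h \<in> borel_measurable ?S" for h
    unfolding P[symmetric] assms(4) using nn_integral_distr[OF X, of h] that by (simp only: measurable_distr_eq1)
  have D: "countable ?D"
  proof (rule countable_finite, rule finite_subset)
    show "?D \<subseteq> Pow ?V \<times> Pow ?V" by blast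
  qed simp
  have core: "(\<integral>\<^sup>+\<omega>. (SUP (I, J)\<in>?D. F I (X \<omega>) * G J (X \<omega>)) \<partial>\<Omega>)
      \<le> (\<integral>\<^sup>+\<omega>. (SUP I\<in>Pow ?V. F I (X \<omega>)) \<partial>\<Omega>) * (\<integral>\<^sup>+\<omega>. (SUP J\<in>Pow ?V. G J (X \<omega>)) \<partial>\<Omega>)"
    if F: "\<And>I. I \<subseteq> ?V \<Longrightarrow> F I \<in> borel_measurable ?S" "\<And>I. depends_on (space ?S) (F I) I"
      and G: "\<And>J. J \<subseteq> ?V \<Longrightarrow> G J \<in> borel_measurable ?S" "\<And>J. depends_on (space ?S) (G J) J"
    for F G :: "nat set \<Rightarrow> (nat \<Rightarrow> 'a) \<Rightarrow> ennreal"
  proof -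
    have meas: "(\<lambda>x. SUP (I, J)\<in>?D. F I x * G J x) \<in> borel_measurable ?S"
      "(\<lambda>x. SUP I\<in>Pow ?V. F I x) \<in> borel_measurable ?S"
      "(\<lambda>x. SUP J\<in>Pow ?V. G J x) \<in> borel_measurable ?S"
      by (intro borel_measurable_SUP D; use F(1) G(1) in \<open>auto intro: countable_finite\<close>)+
    show ?thesis
      unfolding law[OF meas(1)] law[OF meas(2)] law[OF meas(3)]
      by (rule functional_bkr[OF finite_atLeastAtMost M]) (simp_all only: space_M meas_PiM F G)
  qed
  show ?thesis
  proof (intro conjI allI impI; (elim conjE)?)
    fix A :: "'k set" and B :: "'l set" and f g K L
    assume f: "dependent_family n S A f K" and g: "dependent_family n S B g L"
    have sub: "K ` A \<subseteq> Pow ?V" "L ` B \<subseteq> Pow ?V"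
      using f g by (auto simp: dependent_family_def)
    have "(\<integral>\<^sup>+\<omega>. (SUP (I, J)\<in>?D. sup_within A f K I (X \<omega>) * sup_within B g L J (X \<omega>)) \<partial>\<Omega>)
      \<le> (\<integral>\<^sup>+\<omega>. (SUP I\<in>Pow ?V. sup_within A f K I (X \<omega>)) \<partial>\<Omega>) *
        (\<integral>\<^sup>+\<omega>. (SUP J\<in>Pow ?V. sup_within B g L J (X \<omega>)) \<partial>\<Omega>)"
      by (intro core borel_measurable_sup_within sup_within_depends_on f g)
    also have "\<dots> \<le> (\<integral>\<^sup>+\<omega>. (SUP \<alpha>\<in>A. ennreal (f \<alpha> (X \<omega>))) \<partial>\<Omega>) *
        (\<integral>\<^sup>+\<omega>. (SUP \<beta>\<in>B. ennreal (g \<beta> (X \<omega>))) \<partial>\<Omega>)"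
      unfolding sup_within_def
      by (intro mult_mono nn_integral_mono SUP_least SUP_subset_mono) auto
    finally have max: "(\<integral>\<^sup>+\<omega>. (SUP (I, J)\<in>?D. sup_within A f K I (X \<omega>) * sup_within B g L J (X \<omega>)) \<partial>\<Omega>)
      \<le> (\<integral>\<^sup>+\<omega>. (SUP \<alpha>\<in>A. ennreal (f \<alpha> (X \<omega>))) \<partial>\<Omega>) *
        (\<integral>\<^sup>+\<omega>. (SUP \<beta>\<in>B. ennreal (g \<beta> (X \<omega>))) \<partial>\<Omega>)" .
    have "(\<integral>\<^sup>+\<omega>. (SUP (I, J)\<in>{(I, J). I \<in> K ` A \<and> J \<in> L ` B \<and> I \<inter> J = {}}.
          sup_within A f K I (X \<omega>) * sup_within B g L J (X \<omega>)) \<partial>\<Omega>)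
      \<le> (\<integral>\<^sup>+\<omega>. (SUP (I, J)\<in>?D. sup_within A f K I (X \<omega>) * sup_within B g L J (X \<omega>)) \<partial>\<Omega>)"
      using sub by (intro nn_integral_mono SUP_subset_mono) auto
    from this max show "(\<integral>\<^sup>+\<omega>. (SUP (I, J)\<in>{(I, J). I \<in> K ` A \<and> J \<in> L ` B \<and> I \<inter> J = {}}.
          sup_within A f K I (X \<omega>) * sup_within B g L J (X \<omega>)) \<partial>\<Omega>)
      \<le> (\<integral>\<^sup>+\<omega>. (SUP \<alpha>\<in>A. ennreal (f \<alpha> (X \<omega>))) \<partial>\<Omega>) *
        (\<integral>\<^sup>+\<omega>. (SUP \<beta>\<in>B. ennreal (g \<beta> (X \<omega>))) \<partial>\<Omega>)"
      by (rule order.trans)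
    fix \<kappa> \<mu> assume choice: "disjoint_choice n S (K ` A) (L ` B) \<kappa> \<mu>"
    have "(\<integral>\<^sup>+\<omega>. sup_within A f K (\<kappa> (X \<omega>)) (X \<omega>) * sup_within B g L (\<mu> (X \<omega>)) (X \<omega>) \<partial>\<Omega>)
      \<le> (\<integral>\<^sup>+\<omega>. (SUP (I, J)\<in>?D. sup_within A f K I (X \<omega>) * sup_within B g L J (X \<omega>)) \<partial>\<Omega>)"
    proof (rule nn_integral_mono)
      fix \<omega> assume "\<omega> \<in> space \<Omega>"
      then have "X \<omega> \<in> space ?S" by (rule measurable_space[OF X])
      then have "(\<kappa> (X \<omega>), \<mu> (X \<omega>)) \<in> ?D"
        using choice sub unfolding disjoint_choice_def by blast
      then show "sup_within A f K (\<kappa> (X \<omega>)) (X \<omega>) * sup_within B g L (\<mu> (X \<omega>)) (X \<omega>)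
          \<le> (SUP (I, J)\<in>?D. sup_within A f K I (X \<omega>) * sup_within B g L J (X \<omega>))"
        by (rule SUP_upper2) simp
    qed
    from this max show "(\<integral>\<^sup>+\<omega>. sup_within A f K (\<kappa> (X \<omega>)) (X \<omega>) * sup_within B g L (\<mu> (X \<omega>)) (X \<omega>) \<partial>\<Omega>)
      \<le> (\<integral>\<^sup>+\<omega>. (SUP \<alpha>\<in>A. ennreal (f \<alpha> (X \<omega>))) \<partial>\<Omega>) *
        (\<integral>\<^sup>+\<omega>. (SUP \<beta>\<in>B. ennreal (g \<beta> (X \<omega>))) \<partial>\<Omega>)"
      by (rule order.trans)
  next
    fix f g :: "(nat \<Rightarrow> 'a) \<Rightarrow> real" and \<K> \<L> \<kappa> \<mu>
    assume fg: "f \<in> borel_measurable ?S" "g \<in> borel_measurable ?S"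
      and sub: "\<K> \<subseteq> Pow ?V" "\<L> \<subseteq> Pow ?V" and choice: "disjoint_choice n S \<K> \<L> \<kappa> \<mu>"
    have meas: "lower_fun n S P h I \<in> borel_measurable ?S"
      if "h \<in> borel_measurable ?S" "I \<subseteq> ?V" for h I
      using borel_measurable_lower_fun[where f = h and M = M and S = S and n = n, OF M sets_M _ that(2)] that(1) by (simp only: P meas_PiM)
    have below: "(\<integral>\<^sup>+\<omega>. (SUP I\<in>Pow ?V. lower_fun n S P h I (X \<omega>)) \<partial>\<Omega>) \<le> (\<integral>\<^sup>+\<omega>. ennreal (h (X \<omega>)) \<partial>\<Omega>)"
      if h: "h \<in> borel_measurable ?S" for h
    proof -
      have "AE x in P. \<forall>I\<in>Pow ?V. lower_fun n S P h I x \<le> ennreal (h x)"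
      proof (rule AE_finite_allI)
        fix I assume I: "I \<in> Pow ?V"
        have h': "h \<in> borel_measurable (\<Pi>\<^sub>M i\<in>?V. M i)"
          unfolding meas_PiM by (rule h)
        show "AE x in P. lower_fun n S P h I x \<le> ennreal (h x)"
          unfolding P by (rule AE_lower_fun_le[OF M sets_M h' PowD[OF I]])
      qed simp
      then have "(\<integral>\<^sup>+x. (SUP I\<in>Pow ?V. lower_fun n S P h I x) \<partial>P) \<le> (\<integral>\<^sup>+x. ennreal (h x) \<partial>P)"
        by (intro nn_integral_mono_AE) (auto elim!: eventually_mono intro: SUP_least)
      moreover have sup: "(\<lambda>x. SUP I\<in>Pow ?V. lower_fun n S P h I x) \<in> borel_measurable ?S"
        using meas[OF h] by (intro borel_measurable_SUP) (auto intro: countable_finite)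
      moreover have enn: "(\<lambda>x. ennreal (h x)) \<in> borel_measurable ?S"
        by (rule measurable_compose[OF h measurable_ennreal])
      ultimately show ?thesis
        unfolding law[OF sup] law[OF enn] by (simp only: P)
    qed
    have "(\<integral>\<^sup>+\<omega>. lower_fun n S P f (\<kappa> (X \<omega>)) (X \<omega>) * lower_fun n S P g (\<mu> (X \<omega>)) (X \<omega>) \<partial>\<Omega>)
      \<le> (\<integral>\<^sup>+\<omega>. (SUP (I, J)\<in>?D. lower_fun n S P f I (X \<omega>) * lower_fun n S P g J (X \<omega>)) \<partial>\<Omega>)"
    proof (rule nn_integral_mono)
      fix \<omega> assume "\<omega> \<in> space \<Omega>"
      then have "X \<omega> \<in> space ?S" by (rule measurable_space[OF X])
      then have "(\<kappa> (X \<omega>), \<mu> (X \<omega>)) \<in> ?D"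
        using choice sub unfolding disjoint_choice_def by blast
      then show "lower_fun n S P f (\<kappa> (X \<omega>)) (X \<omega>) * lower_fun n S P g (\<mu> (X \<omega>)) (X \<omega>)
          \<le> (SUP (I, J)\<in>?D. lower_fun n S P f I (X \<omega>) * lower_fun n S P g J (X \<omega>))"
        by (rule SUP_upper2) simp
    qed
    also have "\<dots> \<le> (\<integral>\<^sup>+\<omega>. (SUP I\<in>Pow ?V. lower_fun n S P f I (X \<omega>)) \<partial>\<Omega>) *
        (\<integral>\<^sup>+\<omega>. (SUP J\<in>Pow ?V. lower_fun n S P g J (X \<omega>)) \<partial>\<Omega>)"
      by (intro core meas lower_fun_depends_on fg)
    also have "\<dots> \<le> (\<integral>\<^sup>+\<omega>. ennreal (f (X \<omega>)) \<partial>\<Omega>) * (\<integral>\<^sup>+\<omega>. ennreal (g (X \<omega>)) \<partial>\<Omega>)"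
      by (intro mult_mono below fg) auto
    finally show "(\<integral>\<^sup>+\<omega>. lower_fun n S P f (\<kappa> (X \<omega>)) (X \<omega>) * lower_fun n S P g (\<mu> (X \<omega>)) (X \<omega>) \<partial>\<Omega>)
      \<le> (\<integral>\<^sup>+\<omega>. ennreal (f (X \<omega>)) \<partial>\<Omega>) * (\<integral>\<^sup>+\<omega>. ennreal (g (X \<omega>)) \<partial>\<Omega>)" .
  qed
qed

end
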